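(* Let $0<q<1$ be fixed. For positive integers $k$ and $l$, \begin{align*} &(-1)^{k-1}S\left[\left.\begin{matrix} l+1, & 1\\ q^l, & q\end{matrix}\right|\begin{matrix} k\\ q\end{matrix}\right]+(-1)^{l-1}S\left[\left.\begin{matrix} k, & 1\\ q^{k-1}, & q\end{matrix}\right|\begin{matrix} l+1\\ q\end{matrix}\right]\\ =&\mathrm{Li}_{l+1}[q^l]\mathrm{Li}_{k+1}[q^k]+\sum_{j=1}^{k-1}(-1)^{j-1}\mathrm{Li}_{k+1-j}[q^{k-j}]\,S\left[\left.\begin{matrix} j\\ q\end{matrix}\right|\begin{matrix} l+1\\ q^l\end{matrix}\right] +(-1)^{k-1}\mathrm{Li}_{l+1}[q^l]\,S\left[\left.\begin{matrix} 1\\ q\end{matrix}\right|\begin{matrix} k\\ q\end{matrix}\right]\\ &\quad-\sum_{j=1}^{k-1}(-1)^{j-1}\mathrm{Li}_{k+1-j}[q^{k-j}]\mathrm{Li}_{l+j+1}[q^{l+1}]-\sum_{j=1}^{l-1}(-1)^{j-1}\mathrm{Li}_{l+1-j}[q^{l-j}]\,S\left[\left.\begin{matrix} k\\ q^{k-1}\end{matrix}\right|\begin{matrix} j+1\\ q\end{matrix}\right]. \end{align*}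
   Context: Fix $0<q<1$ and set $[m]=\frac{1-q^m}{1-q}$. For a positive integer $k$ and $-1\le x\le 1$, $\zeta_m[k,x]:=\sum_{j=1}^m\frac{x^j}{[j]^k}$. For $|x|<1$, $\mathrm{Li}_k[x]:=\sum_{m=1}^\infty\frac{x^m}{[m]^k}$. For positive integers $k_1,\ldots,k_n,k$, reals $x_1,\ldots,x_n\in[-1,1]$ and $x\in(-1,1)$, $$S\left[\left.\begin{matrix} k_1,\ldots,k_n\\ x_1,\ldots,x_n\end{matrix}\right|\begin{matrix} k\\ x\end{matrix}\right]:=\sum_{m=1}^\infty\frac{\zeta_m[k_1,x_1]\cdots\zeta_m[k_n,x_n]}{[m]^k}x^m.$$ *)

theory Defs
  imports "HOL-Analysis.Analysis"
begin

definition qbracket :: "real \<Rightarrow> nat \<Rightarrow> real" where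
  "qbracket q m = (1 - q ^ m) / (1 - q)"

definition qzeta :: "real \<Rightarrow> nat \<Rightarrow> nat \<Rightarrow> real \<Rightarrow> real" where
  "qzeta q m k x = (\<Sum>j=1..m. x ^ j / qbracket q j ^ k)"

text \<open>In the two series below the summation index is shifted: the bound variable \<open>m\<close>
  stands for \<open>m - 1\<close> of the usual notation, where the sum starts at \<open>1\<close>.\<close>

definition qLi :: "real \<Rightarrow> nat \<Rightarrow> real \<Rightarrow> real" where
  "qLi q k x = (\<Sum>m. x ^ Suc m / qbracket q (Suc m) ^ k)"

text \<open>The list consists of the columns \<open>(k\<^sub>i, x\<^sub>i)\<close> to the left of the bar;
  \<open>k\<close> and \<open>x\<close> form the column to its right.\<close>

definition qS :: "real \<Rightarrow> (nat \<times> real) list \<Rightarrow> nat \<Rightarrow> real \<Rightarrow> real" where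
  "qS q cs k x =
     (\<Sum>m. (\<Prod>(k', x')\<leftarrow>cs. qzeta q (Suc m) k' x') / qbracket q (Suc m) ^ k * x ^ Suc m)"

end

theory Submission
  imports Defs
begin

text \<open>Let \<open>A k n = (\<Sum>m\<ge>1. q ^ (k * m) / ([m] ^ k * [m + n]))\<close>. Since \<open>[m + n] = [m] + q ^ m * [n]\<close>,
  partial fractions give \<open>A (k + 1) n = (Li (k + 1) [q ^ k] - A k n) / [n]\<close>, so \<open>A k n\<close> is a combination of
  \<open>Li (k + 1 - j) [q ^ (k - j)] / [n] ^ j\<close> for \<open>1 \<le> j < k\<close> and \<open>\<zeta> n [1, q] / [n] ^ k\<close>. Weighting this by
  \<open>q ^ n\<close>, by \<open>q ^ n * \<zeta> n [l + 1, q ^ l]\<close> and, with \<open>l\<close> in place of \<open>k\<close>, by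
  \<open>q ^ n * \<zeta> n [k, q ^ (k - 1)] / [n]\<close>, and summing over \<open>n\<close>, produces all the series of the claim up to
  a stuffle product. What remains is a relation between two triple series with nonnegative terms,
  obtained by exchanging the order of summation and telescoping.\<close>

section \<open>Real series: exchange of summation, telescoping, stuffle products\<close>

text \<open>Tonelli for double series, phrased with \<open>sums\<close>: nonnegativity turns every
  \<open>sums\<close> into an unconditional \<open>has_sum\<close>, and the family over all pairs
  may then be summed by rows or by columns.\<close>

lemma sums_swap_nonneg:
  fixes f :: "nat \<Rightarrow> nat \<Rightarrow> real"
  assumes nonneg: "\<And>i j. 0 \<le> f i j"
    and rows: "\<And>i. f i sums g i" and total: "g sums s"
    and cols: "\<And>j. (\<lambda>i. f i j) sums h j"
  shows "h sums s"
proof -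
  have g0: "0 \<le> g i" for i
    by (rule sums_le[OF _ sums_zero rows]) (rule nonneg)
  have h0: "0 \<le> h j" for j
    by (rule sums_le[OF _ sums_zero cols]) (rule nonneg)
  have gs: "(g has_sum s) UNIV"
    using total g0 by (simp add: sums_nonneg_imp_has_sum)
  have fs: "(f i has_sum g i) UNIV" for i
    using rows nonneg by (simp add: sums_nonneg_imp_has_sum)
  have hs: "((\<lambda>i. f i j) has_sum h j) UNIV" for j
    using cols nonneg by (simp add: sums_nonneg_imp_has_sum)
  have "(\<lambda>(i, j). f i j) summable_on UNIV \<times> UNIV"
    by (rule summable_on_SigmaI[where g = g]) (use fs gs nonneg in \<open>auto simp: summable_on_def\<close>)
  then obtain t where t: "((\<lambda>(i, j). f i j) has_sum t) (UNIV \<times> UNIV)"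
    by (auto simp: summable_on_def)
  \<comment> \<open>Summing the double family by rows identifies its total \<open>t\<close> with the
    given \<open>s\<close>.\<close>
  have "(g has_sum t) UNIV"
    by (rule has_sum_SigmaD[OF t]) (use fs in auto)
  then have "t = s"
    using gs by (rule has_sum_unique)
  have "((\<lambda>(j, i). f i j) has_sum t) (UNIV \<times> UNIV)"
    using has_sum_swap[of "\<lambda>(i, j). f i j" UNIV UNIV t] t by simp
  then have "(h has_sum t) UNIV"
    by (rule has_sum_SigmaD) (use hs in auto)
  then show ?thesis
    using \<open>t = s\<close> by (simp add: has_sum_imp_sums)
qed

text \<open>Raising the lag \<open>i\<close> by one adds an ordinary telescoping series that starts
  at \<open>u i\<close> and ends at the limit 0.\<close>

lemma sums_diff_shift:
  fixes u :: "nat \<Rightarrow> real"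
  assumes "u \<longlonglongrightarrow> 0"
  shows "(\<lambda>n. u n - u (n + i)) sums (\<Sum>n<i. u n)"
proof (induction i)
  case (Suc i)
  have "(\<lambda>n. u (n + i)) \<longlonglongrightarrow> 0"
    using assms by (rule LIMSEQ_ignore_initial_segment)
  then have "(\<lambda>n. u (n + i) - u (Suc n + i)) sums (u (0 + i) - 0)"
    by (rule telescope_sums')
  from sums_add[OF Suc this] show ?case
    by simp
qed simp

text \<open>The partial sums satisfy the corresponding finite identity exactly.\<close>

lemma suminf_stuffle:
  fixes f g :: "nat \<Rightarrow> real"
  assumes f: "summable f" and g: "summable g"
    and fg: "summable (\<lambda>n. (\<Sum>j\<le>n. f j) * g n)" and gf: "summable (\<lambda>n. (\<Sum>j\<le>n. g j) * f n)"
    and p: "summable (\<lambda>n. f n * g n)"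
  shows "(\<Sum>n. (\<Sum>j\<le>n. f j) * g n) + (\<Sum>n. (\<Sum>j\<le>n. g j) * f n)
    = suminf f * suminf g + (\<Sum>n. f n * g n)"
proof (rule LIMSEQ_unique)
  have partial: "(\<Sum>n<N. (\<Sum>j\<le>n. f j) * g n) + (\<Sum>n<N. (\<Sum>j\<le>n. g j) * f n)
      = (\<Sum>n<N. f n) * (\<Sum>n<N. g n) + (\<Sum>n<N. f n * g n)" for N
  proof (induction N)
    case (Suc N)
    then show ?case
      unfolding sum.lessThan_Suc lessThan_Suc_atMost[symmetric] by (simp add: algebra_simps)
  qed simp
  show "(\<lambda>N. (\<Sum>n<N. (\<Sum>j\<le>n. f j) * g n) + (\<Sum>n<N. (\<Sum>j\<le>n. g j) * f n))
      \<longlonglongrightarrow> (\<Sum>n. (\<Sum>j\<le>n. f j) * g n) + (\<Sum>n. (\<Sum>j\<le>n. g j) * f n)"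
    by (intro tendsto_add summable_LIMSEQ fg gf)
  show "(\<lambda>N. (\<Sum>n<N. (\<Sum>j\<le>n. f j) * g n) + (\<Sum>n<N. (\<Sum>j\<le>n. g j) * f n))
      \<longlonglongrightarrow> suminf f * suminf g + (\<Sum>n. f n * g n)"
    unfolding partial by (intro tendsto_add tendsto_mult summable_LIMSEQ f g p)
qed

text \<open>Differentiating a power series termwise and multiplying by \<open>x\<close> raises the
  exponent \<open>p\<close> by one. These series serve as majorants for \<open>qS\<close>.\<close>

lemma summable_nat_power_mult_power:
  fixes x :: real
  assumes "\<bar>x\<bar> < 1"
  shows "summable (\<lambda>n. real n ^ p * x ^ n)"
  using assms
proof (induction p arbitrary: x)
  case (Suc p)
  have "summable (\<lambda>n. diffs (\<lambda>n. real n ^ p) n * x ^ n)"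
    by (rule termdiff_converges[where K = 1]) (use Suc in auto)
  then have "summable (\<lambda>n. x * (diffs (\<lambda>n. real n ^ p) n * x ^ n))"
    by (rule summable_mult)
  then have "summable (\<lambda>n. real (Suc n) ^ Suc p * x ^ Suc n)"
    by (simp add: diffs_def mult_ac del: of_nat_Suc)
  then show ?case
    by (simp only: summable_Suc_iff[of "\<lambda>n. real n ^ Suc p * x ^ n"])
qed (simp add: summable_geometric)

text \<open>This is \<open>A k n\<close> of the overview. The summation index is shifted as in
  \<open>qLi\<close>, whereas \<open>n\<close> is not.\<close>

definition shifted_qLi :: "real \<Rightarrow> nat \<Rightarrow> nat \<Rightarrow> real" where
  "shifted_qLi q k n = (\<Sum>m. (q ^ k) ^ Suc m / (qbracket q (Suc m) ^ k * qbracket q (Suc m + n)))"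

context
  fixes q :: real
  assumes q_pos: "0 < q" and q_less_1: "q < 1"
begin

section \<open>Brackets and partial fractions\<close>

lemma qbracket_ge_1: "1 \<le> qbracket q (Suc n)"
proof -
  have "q ^ Suc n \<le> q"
    using q_pos q_less_1 by (simp add: mult_left_le power_le_one)
  then show ?thesis
    using q_less_1 by (simp add: qbracket_def)
qed

lemma qbracket_pos: "0 < n \<Longrightarrow> 0 < qbracket q n"
  using qbracket_ge_1[of "n - 1"] by simp

lemma qbracket_add: "qbracket q (m + n) = qbracket q m + q ^ m * qbracket q n"
  using q_less_1 by (simp add: qbracket_def field_simps power_add)

text \<open>Up to the constant \<open>1 - q\<close>, which cancels in differences, the reciprocal
  equals a null sequence. Telescoping requires this form, since \<open>1 / qbracket q n\<close>
  itself tends to \<open>1 - q\<close>.\<close>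

lemma inverse_qbracket: "0 < n \<Longrightarrow> 1 / qbracket q n = (1 - q) + q ^ n / qbracket q n"
  using q_less_1 qbracket_pos[of n] by (simp add: qbracket_def field_simps)

lemma partial_fraction:
  assumes "0 < m" "0 < n"
  shows "q ^ m / (qbracket q m * qbracket q (m + n)) = (1 / qbracket q m - 1 / qbracket q (m + n)) / qbracket q n"
proof -
  have "q ^ m = (qbracket q (m + n) - qbracket q m) / qbracket q n"
    using qbracket_pos[OF assms(2)] by (simp add: qbracket_add)
  then show ?thesis
    using qbracket_pos[OF assms(1)] qbracket_pos[of "m + n"] assms
    by (simp add: diff_frac_eq)
qed

text \<open>By partial fractions the series telescopes with lag \<open>i\<close>. The case
  \<open>m = 1\<close> evaluates \<open>shifted_qLi q 1\<close>; general \<open>m\<close> is used in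
  \<open>qLi_exchange\<close>.\<close>

lemma partial_fraction_sums:
  assumes "0 < m" "0 < i"
  shows "(\<lambda>n. q ^ (m + n) / (qbracket q (m + n) * qbracket q (m + n + i)))
    sums ((\<Sum>n<i. q ^ (m + n) / qbracket q (m + n)) / qbracket q i)"
proof -
  define u where "u n = q ^ (m + n) / qbracket q (m + n)" for n
  have le: "\<bar>u n\<bar> \<le> q ^ n" for n
  proof -
    have "q ^ (m + n) \<le> q ^ n"
      using q_pos q_less_1 by (simp add: power_decreasing)
    moreover have "1 \<le> qbracket q (m + n)"
      using qbracket_ge_1[of "m + n - 1"] assms by simp
    ultimately have "q ^ (m + n) / qbracket q (m + n) \<le> q ^ n / 1"
      using q_pos by (intro frac_le) auto
    then show ?thesis
      using q_pos \<open>1 \<le> qbracket q (m + n)\<close> by (simp add: u_def)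
  qed
  have "u \<longlonglongrightarrow> 0"
    by (rule Lim_null_comparison[where g = "\<lambda>n. q ^ n"])
      (use le q_pos q_less_1 in \<open>auto intro!: LIMSEQ_realpow_zero\<close>)
  then have "(\<lambda>n. (u n - u (n + i)) / qbracket q i) sums ((\<Sum>n<i. u n) / qbracket q i)"
    by (intro sums_divide sums_diff_shift)
  moreover have "(u n - u (n + i)) / qbracket q i
      = q ^ (m + n) / (qbracket q (m + n) * qbracket q (m + n + i))" for n
    using inverse_qbracket[of "m + n"] inverse_qbracket[of "m + n + i"] assms
    by (subst partial_fraction) (auto simp: u_def add.assoc)
  ultimately show ?thesis
    by (simp add: u_def)
qed

section \<open>Convergence and the stuffle product\<close>

lemma abs_qzeta_le:
  assumes "\<bar>x\<bar> \<le> 1"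
  shows "\<bar>qzeta q n k x\<bar> \<le> real n"
proof -
  have "\<bar>x ^ j / qbracket q j ^ k\<bar> \<le> 1" if "j \<in> {1..n}" for j
  proof -
    have "1 \<le> qbracket q j ^ k"
      using qbracket_ge_1[of "j - 1"] that by (simp add: one_le_power)
    moreover have "\<bar>x\<bar> ^ j \<le> 1"
      using assms by (simp add: power_le_one)
    ultimately have "\<bar>x\<bar> ^ j / \<bar>qbracket q j ^ k\<bar> \<le> 1 / 1"
      by (intro frac_le) auto
    then show ?thesis
      by (simp add: power_abs)
  qed
  then have "(\<Sum>j=1..n. \<bar>x ^ j / qbracket q j ^ k\<bar>) \<le> (\<Sum>j=1..n. 1)"
    by (intro sum_mono)
  moreover have "\<bar>qzeta q n k x\<bar> \<le> (\<Sum>j=1..n. \<bar>x ^ j / qbracket q j ^ k\<bar>)"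
    unfolding qzeta_def by (rule sum_abs)
  ultimately show ?thesis
    by simp
qed

text \<open>Each factor \<open>qzeta\<close> grows at most linearly, so a polynomial times a
  geometric sequence dominates the terms.\<close>

lemma summable_qS:
  assumes "\<And>k' x'. (k', x') \<in> set cs \<Longrightarrow> \<bar>x'\<bar> \<le> 1" and "\<bar>x\<bar> < 1"
  shows "summable (\<lambda>n. (\<Prod>(k', x')\<leftarrow>cs. qzeta q (Suc n) k' x') / qbracket q (Suc n) ^ k * x ^ Suc n)"
proof (rule summable_comparison_test')
  show "summable (\<lambda>n. real (Suc n) ^ length cs * \<bar>x\<bar> ^ Suc n)"
    using assms(2) summable_nat_power_mult_power[of "\<bar>x\<bar>" "length cs"]
    by (subst summable_Suc_iff[of "\<lambda>n. real n ^ length cs * \<bar>x\<bar> ^ n"]) simp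
  fix n :: nat
  have *: "\<bar>\<Prod>(k', x')\<leftarrow>cs. qzeta q (Suc n) k' x'\<bar> \<le> real (Suc n) ^ length cs"
    using assms(1)
  proof (induction cs)
    case (Cons c cs)
    have "\<bar>qzeta q (Suc n) (fst c) (snd c)\<bar> \<le> real (Suc n)"
      by (rule abs_qzeta_le) (use Cons.prems[of "fst c" "snd c"] in simp)
    moreover have "\<bar>\<Prod>(k', x')\<leftarrow>cs. qzeta q (Suc n) k' x'\<bar> \<le> real (Suc n) ^ length cs"
      by (rule Cons.IH) (use Cons.prems in auto)
    ultimately show ?case
      unfolding list.map prod_list.Cons abs_mult case_prod_beta length_Cons power_Suc
      by (intro mult_mono) auto
  qed simp
  have "1 \<le> qbracket q (Suc n) ^ k"
    using qbracket_ge_1 by (rule one_le_power)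
  then have "\<bar>\<Prod>(k', x')\<leftarrow>cs. qzeta q (Suc n) k' x'\<bar> / \<bar>qbracket q (Suc n) ^ k\<bar>
      \<le> real (Suc n) ^ length cs / 1"
    by (intro frac_le *) auto
  then show "norm ((\<Prod>(k', x')\<leftarrow>cs. qzeta q (Suc n) k' x') / qbracket q (Suc n) ^ k * x ^ Suc n)
      \<le> real (Suc n) ^ length cs * \<bar>x\<bar> ^ Suc n"
    unfolding real_norm_def abs_mult abs_divide power_abs
    by (intro mult_right_mono) auto
qed

lemma qS_sums:
  assumes "\<And>k' x'. (k', x') \<in> set cs \<Longrightarrow> \<bar>x'\<bar> \<le> 1" and "\<bar>x\<bar> < 1"
  shows "(\<lambda>n. (\<Prod>(k', x')\<leftarrow>cs. qzeta q (Suc n) k' x') / qbracket q (Suc n) ^ k * x ^ Suc n)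
    sums qS q cs k x"
  unfolding qS_def by (rule summable_sums[OF summable_qS[OF assms]])

lemma qS_Nil: "qS q [] k x = qLi q k x"
  by (simp add: qS_def qLi_def)

lemma qLi_sums:
  assumes "\<bar>x\<bar> < 1"
  shows "(\<lambda>n. x ^ Suc n / qbracket q (Suc n) ^ k) sums qLi q k x"
  using qS_sums[of "[]" x k] assms by (simp add: qS_Nil)

lemma qzeta_Suc_atMost: "qzeta q (Suc n) k x = (\<Sum>j\<le>n. x ^ Suc j / qbracket q (Suc j) ^ k)"
  unfolding qzeta_def by (rule sum.reindex_bij_witness[of _ Suc "\<lambda>j. j - 1"]) auto

text \<open>The two nested sums together cover all index pairs and count the diagonal twice; the
  surplus diagonal is the last \<open>qLi\<close>.\<close>

lemma qS_stuffle:
  assumes "\<bar>x\<bar> < 1" "\<bar>y\<bar> < 1"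
  shows "qS q [(a, x)] b y + qS q [(b, y)] a x = qLi q a x * qLi q b y + qLi q (a + b) (x * y)"
proof -
  have "\<bar>x * y\<bar> < 1"
    using mult_strict_mono'[of "\<bar>x\<bar>" 1 "\<bar>y\<bar>" 1] assms by (simp add: abs_mult)
  then have xy: "(\<lambda>n. (x ^ Suc n / qbracket q (Suc n) ^ a) * (y ^ Suc n / qbracket q (Suc n) ^ b))
      sums qLi q (a + b) (x * y)"
    using qLi_sums[of "x * y" "a + b"] by (simp add: power_add power_mult_distrib ac_simps)
  have 1: "(\<lambda>n. (\<Sum>j\<le>n. x ^ Suc j / qbracket q (Suc j) ^ a) * (y ^ Suc n / qbracket q (Suc n) ^ b))
      sums qS q [(a, x)] b y"
    using qS_sums[of "[(a, x)]" y b] assms by (simp add: qzeta_Suc_atMost)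
  have 2: "(\<lambda>n. (\<Sum>j\<le>n. y ^ Suc j / qbracket q (Suc j) ^ b) * (x ^ Suc n / qbracket q (Suc n) ^ a))
      sums qS q [(b, y)] a x"
    using qS_sums[of "[(b, y)]" x a] assms by (simp add: qzeta_Suc_atMost)
  show ?thesis
    using suminf_stuffle[OF sums_summable[OF qLi_sums[OF assms(1), of a]]
        sums_summable[OF qLi_sums[OF assms(2), of b]]
        sums_summable[OF 1] sums_summable[OF 2] sums_summable[OF xy]]
    unfolding sums_unique[OF 1, symmetric] sums_unique[OF 2, symmetric] sums_unique[OF xy, symmetric]
    by (simp add: qLi_def)
qed

section \<open>Evaluation of the shifted series\<close>

lemma power_less_1: "0 < k \<Longrightarrow> \<bar>q ^ k\<bar> < 1"
  using q_pos q_less_1 by (simp add: power_less_one_iff)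

lemma qbracket_power_ge_1: "1 \<le> qbracket q (Suc n) ^ k"
  using qbracket_ge_1 by (rule one_le_power)

lemma shifted_qLi_sums:
  assumes "0 < k"
  shows "(\<lambda>m. (q ^ k) ^ Suc m / (qbracket q (Suc m) ^ k * qbracket q (Suc m + n))) sums shifted_qLi q k n"
  unfolding shifted_qLi_def
proof (rule summable_sums, rule summable_comparison_test')
  show "summable (\<lambda>m. (q ^ k) ^ Suc m / qbracket q (Suc m) ^ k)"
    using power_less_1[OF assms] by (rule sums_summable[OF qLi_sums])
  fix m :: nat
  have b: "1 \<le> qbracket q (Suc m) ^ k" "1 \<le> qbracket q (Suc m + n)"
    using qbracket_ge_1[of "m + n"] by (simp_all add: qbracket_power_ge_1)
  then have "qbracket q (Suc m) ^ k * 1 \<le> qbracket q (Suc m) ^ k * qbracket q (Suc m + n)"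
    by (intro mult_left_mono) auto
  then show "norm ((q ^ k) ^ Suc m / (qbracket q (Suc m) ^ k * qbracket q (Suc m + n)))
      \<le> (q ^ k) ^ Suc m / qbracket q (Suc m) ^ k"
    using b q_pos unfolding real_norm_def abs_divide abs_mult
    by (intro frac_le) (auto simp: abs_mult)
qed

lemma shifted_qLi_1:
  assumes "0 < n"
  shows "shifted_qLi q 1 n = qzeta q n 1 q / qbracket q n"
proof -
  have "(\<lambda>m. q ^ (1 + m) / (qbracket q (1 + m) * qbracket q (1 + m + n)))
      sums ((\<Sum>m<n. q ^ (1 + m) / qbracket q (1 + m)) / qbracket q n)"
    by (rule partial_fraction_sums) (use assms in auto)
  moreover have "(\<Sum>m<n. q ^ (1 + m) / qbracket q (1 + m)) = qzeta q n 1 q"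
    unfolding qzeta_def by (rule sum.reindex_bij_witness[of _ "\<lambda>j. j - 1" Suc]) auto
  ultimately show ?thesis
    unfolding shifted_qLi_def by (simp add: sums_iff)
qed

text \<open>Partial fractions are applied to one factor
  \<open>q ^ Suc m / (qbracket q (Suc m) * qbracket q (Suc m + n))\<close> of each term.\<close>

lemma shifted_qLi_Suc:
  assumes "0 < k" "0 < n"
  shows "shifted_qLi q (Suc k) n = (qLi q (Suc k) (q ^ k) - shifted_qLi q k n) / qbracket q n"
proof -
  have "(q ^ Suc k) ^ Suc m / (qbracket q (Suc m) ^ Suc k * qbracket q (Suc m + n))
      = ((q ^ k) ^ Suc m / qbracket q (Suc m) ^ Suc k
        - (q ^ k) ^ Suc m / (qbracket q (Suc m) ^ k * qbracket q (Suc m + n))) / qbracket q n" for m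
  proof -
    have "(q ^ Suc k) ^ Suc m / (qbracket q (Suc m) ^ Suc k * qbracket q (Suc m + n))
        = (q ^ k) ^ Suc m / qbracket q (Suc m) ^ k
          * (q ^ Suc m / (qbracket q (Suc m) * qbracket q (Suc m + n)))"
      by (simp add: power_mult_distrib mult_ac)
    also have "\<dots> = (q ^ k) ^ Suc m / qbracket q (Suc m) ^ k
          * ((1 / qbracket q (Suc m) - 1 / qbracket q (Suc m + n)) / qbracket q n)"
      by (subst partial_fraction) (use assms in auto)
    finally show ?thesis
      by (simp add: diff_divide_distrib right_diff_distrib mult_ac)
  qed
  then have "(\<lambda>m. (q ^ Suc k) ^ Suc m / (qbracket q (Suc m) ^ Suc k * qbracket q (Suc m + n)))
      sums ((qLi q (Suc k) (q ^ k) - shifted_qLi q k n) / qbracket q n)"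
    using sums_divide[OF sums_diff[OF qLi_sums[OF power_less_1[OF assms(1)], of "Suc k"]
        shifted_qLi_sums[OF assms(1), of n]], of "qbracket q n"]
    by presburger
  then show ?thesis
    unfolding shifted_qLi_def by (simp add: sums_iff)
qed

text \<open>The recursion is iterated down to \<open>shifted_qLi q 1 n\<close>. Writing the order as
  \<open>Suc k\<close> makes that the base case of the induction.\<close>

lemma shifted_qLi_eq:
  assumes "0 < n"
  shows "shifted_qLi q (Suc k) n
    = (\<Sum>j=1..k. (-1) ^ (j - 1) * qLi q (Suc k + 1 - j) (q ^ (Suc k - j)) / qbracket q n ^ j)
      + (-1) ^ k * qzeta q n 1 q / qbracket q n ^ Suc k"
proof (induction k)
  case 0
  then show ?case
    using shifted_qLi_1[OF assms] by simp
next
  case (Suc k)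
  let ?t = "\<lambda>k j. (-1) ^ (j - 1) * qLi q (Suc k + 1 - j) (q ^ (Suc k - j)) / qbracket q n ^ j"
  have "(\<Sum>j=1..Suc k. ?t (Suc k) j) = ?t (Suc k) 1 + (\<Sum>j=1..k. ?t (Suc k) (Suc j))"
    using sum.atLeast_Suc_atMost[of 1 "Suc k" "?t (Suc k)"]
      sum.shift_bounds_cl_Suc_ivl[of "?t (Suc k)" 1 k]
    by (simp only: One_nat_def)
  \<comment> \<open>The \<open>qLi\<close> factor depends only on the difference of \<open>k\<close>
    and \<open>j\<close>, so raising both leaves it fixed; the sign and one division by the bracket
    account for the change.\<close>
  also have "(\<Sum>j=1..k. ?t (Suc k) (Suc j)) = - (\<Sum>j=1..k. ?t k j) / qbracket q n"
    unfolding sum_negf[symmetric] sum_divide_distrib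
  proof (rule sum.cong)
    fix j assume "j \<in> {1..k}"
    then obtain i where "j = Suc i"
      by (cases j) auto
    then show "?t (Suc k) (Suc j) = - ?t k j / qbracket q n"
      by simp
  qed simp
  finally show ?case
    unfolding shifted_qLi_Suc[OF zero_less_Suc assms] Suc.IH
    by (simp add: diff_divide_distrib add_divide_distrib mult_ac)
qed

text \<open>The parameters \<open>cs\<close> and \<open>p\<close> cover all three weights of the
  overview: \<open>cs\<close> is empty or a single column, and \<open>p = 1\<close> supplies the
  extra division by the bracket in the third.\<close>

lemma shifted_qLi_qS_sums:
  assumes "\<And>k' x'. (k', x') \<in> set cs \<Longrightarrow> \<bar>x'\<bar> \<le> 1" and "0 < k"
  shows "(\<lambda>n. (\<Prod>(k', x')\<leftarrow>cs. qzeta q (Suc n) k' x') / qbracket q (Suc n) ^ p * q ^ Suc n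
      * shifted_qLi q k (Suc n))
    sums ((\<Sum>j=1..k-1. (-1) ^ (j - 1) * qLi q (k + 1 - j) (q ^ (k - j)) * qS q cs (j + p) q)
      + (-1) ^ (k - 1) * qS q (cs @ [(1, q)]) (k + p) q)"
proof -
  obtain k' where k: "k = Suc k'"
    using assms(2) by (cases k) auto
  let ?P = "\<lambda>n. \<Prod>(k', x')\<leftarrow>cs. qzeta q (Suc n) k' x'"
  let ?c = "\<lambda>j. (-1) ^ (j - 1) * qLi q (Suc k' + 1 - j) (q ^ (Suc k' - j))"
  have q: "\<bar>q\<bar> < 1"
    using q_pos q_less_1 by simp
  have "(\<lambda>n. ?P n * qzeta q (Suc n) 1 q / qbracket q (Suc n) ^ (Suc k' + p) * q ^ Suc n)
      sums qS q (cs @ [(1, q)]) (Suc k' + p) q"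
    using qS_sums[of "cs @ [(1, q)]" q "Suc k' + p"] assms(1) q by fastforce
  then have "(\<lambda>n. (\<Sum>j=1..k'. ?c j * (?P n / qbracket q (Suc n) ^ (j + p) * q ^ Suc n))
        + (-1) ^ k' * (?P n * qzeta q (Suc n) 1 q / qbracket q (Suc n) ^ (Suc k' + p) * q ^ Suc n))
      sums ((\<Sum>j=1..k'. ?c j * qS q cs (j + p) q) + (-1) ^ k' * qS q (cs @ [(1, q)]) (Suc k' + p) q)"
    by (intro sums_add sums_sum sums_mult qS_sums assms(1) q)
  moreover have "(\<Sum>j=1..k'. ?c j * (?P n / qbracket q (Suc n) ^ (j + p) * q ^ Suc n))
        + (-1) ^ k' * (?P n * qzeta q (Suc n) 1 q / qbracket q (Suc n) ^ (Suc k' + p) * q ^ Suc n)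
      = ?P n / qbracket q (Suc n) ^ p * q ^ Suc n * shifted_qLi q (Suc k') (Suc n)" for n
    unfolding shifted_qLi_eq[OF zero_less_Suc] distrib_left sum_distrib_left
    by (intro arg_cong2[where f = "(+)"] sum.cong) (simp_all add: power_add mult_ac)
  ultimately show ?thesis
    by (simp only: k diff_Suc_1)
qed

section \<open>The relation between the two triple series\<close>

lemma shifted_qLi_nonneg: "0 < k \<Longrightarrow> 0 \<le> shifted_qLi q k (Suc n)"
  by (rule sums_le[OF _ sums_zero shifted_qLi_sums])
    (use q_pos qbracket_pos in \<open>auto intro!: divide_nonneg_nonneg mult_nonneg_nonneg simp: less_imp_le\<close>)

text \<open>The tail is written as a series over all \<open>i\<close> with zeros up to
  \<open>n\<close>, the shape that \<open>sums_swap_nonneg\<close> accepts.\<close>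

lemma qLi_tail_sums:
  assumes "0 < k"
  shows "(\<lambda>i. if n < i then (q ^ k) ^ Suc i / qbracket q (Suc i) ^ p else 0)
    sums (qLi q p (q ^ k) - qzeta q (Suc n) p (q ^ k))"
proof -
  let ?b = "\<lambda>i. (q ^ k) ^ Suc i / qbracket q (Suc i) ^ p"
  have "(\<lambda>i. ?b i - (if i \<in> {..n} then ?b i else 0)) sums (qLi q p (q ^ k) - (\<Sum>i\<in>{..n}. ?b i))"
    by (intro sums_diff qLi_sums power_less_1 assms sums_If_finite_set) simp
  moreover have "?b i - (if i \<in> {..n} then ?b i else 0) = (if n < i then ?b i else 0)" for i
    by auto
  ultimately show ?thesis
    by (simp only: qzeta_Suc_atMost)
qed

text \<open>Expanding both series over triples \<open>(m, i, n)\<close> and summing over \<open>n\<close> first, the inner sum is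
  \<open>\<Sum>n=1..i-1. q ^ n / [m + n]\<close> on the left, and on the right, by telescoping, the same with
  the additional summand \<open>n = 0\<close>, which contributes the product of the two \<open>qLi\<close>.\<close>

lemma qLi_exchange:
  assumes "0 < k" "0 < l"
  obtains s where
    "(\<lambda>n. q ^ Suc n * shifted_qLi q k (Suc n) * (qLi q (Suc l) (q ^ l) - qzeta q (Suc n) (Suc l) (q ^ l)))
      sums s"
    "(\<lambda>n. qzeta q (Suc n) k (q ^ (k - 1)) / qbracket q (Suc n) * q ^ Suc n * shifted_qLi q l (Suc n))
      sums (s + qLi q (Suc l) (q ^ l) * qLi q (Suc k) (q ^ k))"
proof -
  define a where "a m = (q ^ k) ^ Suc m / qbracket q (Suc m) ^ k" for m
  define b where "b i = (q ^ l) ^ Suc i / qbracket q (Suc i) ^ Suc l" for i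
  define c where "c m = (q ^ (k - 1)) ^ Suc m / qbracket q (Suc m) ^ k" for m
  define L where "L = qLi q (Suc l) (q ^ l)"
  define B where "B n = L - qzeta q (Suc n) (Suc l) (q ^ l)" for n
  define R where "R m i = (\<Sum>n<i. q ^ Suc n / qbracket q (Suc m + Suc n))" for m i
  define P where "P m = (\<Sum>i. b i * R m i)" for m
  define s where "s = (\<Sum>m. a m * P m)"
  have br0: "0 \<le> qbracket q n" for n
    using qbracket_pos[of n] by (cases "n = 0") (auto simp: qbracket_def)
  have q0: "0 \<le> q"
    using q_pos by simp
  have a0: "0 \<le> a m" for m
    using q0 br0 by (simp add: a_def)
  have b0: "0 \<le> b i" for i
    using q0 br0 by (simp add: b_def)
  have c0: "0 \<le> c i" for i
    using q0 br0 by (simp add: c_def)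
  \<comment> \<open>The factor by which \<open>c\<close> and \<open>a\<close> differ is supplied by
    the weight \<open>q ^ (Suc m + n)\<close> in \<open>right\<close>.\<close>
  have ca: "c m * q ^ Suc m = a m" for m
  proof -
    have "q ^ k = q ^ (k - 1) * q"
      using assms(1) by (metis power_minus_mult)
    then show ?thesis
      by (simp only: a_def c_def power_mult_distrib times_divide_eq_left)
  qed
  have bL: "b sums L"
    unfolding b_def L_def by (intro qLi_sums power_less_1 assms)
  have aL: "a sums qLi q k (q ^ k)"
    unfolding a_def by (intro qLi_sums power_less_1 assms)
  have aL': "(\<lambda>m. a m / qbracket q (Suc m)) sums qLi q (Suc k) (q ^ k)"
    using qLi_sums[OF power_less_1[OF assms(1)], of "Suc k"] by (simp add: a_def mult.commute)
  have L0: "0 \<le> L"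
    by (rule sums_le[OF _ sums_zero bL]) (rule b0)
  have BL: "(\<lambda>i. if n < i then b i else 0) sums B n" for n
    unfolding b_def B_def L_def using qLi_tail_sums[OF assms(2)] .
  have B0: "0 \<le> B n" for n
    by (rule sums_le[OF _ sums_zero BL[of n]]) (simp add: b0)
  have R0: "0 \<le> R m i" for m i
    using q0 br0 by (auto simp: R_def intro!: sum_nonneg divide_nonneg_nonneg)
  \<comment> \<open>A bound uniform in \<open>m\<close> and \<open>i\<close> makes both series
    \<open>P m\<close> and \<open>s\<close> converge.\<close>
  have R_le: "R m i \<le> 1 / (1 - q)" for m i
  proof -
    have "R m i \<le> (\<Sum>n<i. q ^ n)"
      unfolding R_def
    proof (rule sum_mono)
      fix n
      have "q ^ Suc n \<le> q ^ n"
        using q0 q_less_1 by (simp add: mult_left_le_one_le)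
      moreover have "1 \<le> qbracket q (Suc m + Suc n)"
        using qbracket_ge_1[of "m + Suc n"] by simp
      ultimately have "q ^ Suc n / qbracket q (Suc m + Suc n) \<le> q ^ n / 1"
        using q0 by (intro frac_le) auto
      then show "q ^ Suc n / qbracket q (Suc m + Suc n) \<le> q ^ n"
        by simp
    qed
    also have "\<dots> \<le> (\<Sum>n. q ^ n)"
      by (rule sum_le_suminf) (use q0 q_less_1 in \<open>auto simp: summable_geometric\<close>)
    also have "\<dots> = 1 / (1 - q)"
      using q0 q_less_1 by (simp add: suminf_geometric)
    finally show ?thesis .
  qed
  have bR_le: "b i * R m i \<le> b i * (1 / (1 - q))" for m i
    using b0 R_le by (rule mult_left_mono[rotated])
  have bR: "(\<lambda>i. b i * R m i) sums P m" for m
    unfolding P_def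
    by (rule summable_sums, rule summable_comparison_test'[OF sums_summable[OF sums_mult2[OF bL, of "1 / (1 - q)"]]])
      (use bR_le b0 R0 in \<open>simp add: abs_mult\<close>)
  have P0: "0 \<le> P m" for m
    by (rule sums_le[OF _ sums_zero bR]) (simp add: b0 R0)
  have P_le: "P m \<le> L * (1 / (1 - q))" for m
    by (rule sums_le[OF bR_le bR sums_mult2[OF bL]])
  have aP: "(\<lambda>m. a m * P m) sums s"
    unfolding s_def
    by (rule summable_sums, rule summable_comparison_test'[OF sums_summable[OF sums_mult2[OF aL, of "L * (1 / (1 - q))"]]])
      (use mult_left_mono[OF P_le a0] P0 a0 in \<open>simp add: abs_mult\<close>)
  \<comment> \<open>For fixed \<open>m\<close>, summation runs over pairs \<open>n < i\<close>.
    Summing over \<open>n\<close> first gives \<open>R m i\<close>, summing over \<open>i\<close>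
    first gives the tail \<open>B n\<close>.\<close>
  have left: "(\<lambda>n. q ^ Suc n / qbracket q (Suc m + Suc n) * B n) sums P m" for m
  proof (rule sums_swap_nonneg[OF _ _ bR])
    let ?f = "\<lambda>i n. if n < i then b i * (q ^ Suc n / qbracket q (Suc m + Suc n)) else 0"
    show "0 \<le> ?f i n" for i n
      using b0 q0 br0 by auto
    show "?f i sums (b i * R m i)" for i
      using sums_If_finite_set[of "{..<i}" "\<lambda>n. b i * (q ^ Suc n / qbracket q (Suc m + Suc n))"]
      by (simp add: R_def sum_distrib_left)
    show "(\<lambda>i. ?f i n) sums (q ^ Suc n / qbracket q (Suc m + Suc n) * B n)" for n
      using sums_mult[OF BL[of n], of "q ^ Suc n / qbracket q (Suc m + Suc n)"]
      by (simp add: if_distrib mult.commute cong: if_cong)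
  qed
  have "(\<lambda>n. q ^ Suc n * shifted_qLi q k (Suc n) * B n) sums s"
  proof (rule sums_swap_nonneg[OF _ _ aP])
    let ?f = "\<lambda>m n. a m * (q ^ Suc n / qbracket q (Suc m + Suc n) * B n)"
    show "0 \<le> ?f m n" for m n
      using a0 q0 br0 B0 by simp
    show "?f m sums (a m * P m)" for m
      by (intro sums_mult left)
    show "(\<lambda>m. ?f m n) sums (q ^ Suc n * shifted_qLi q k (Suc n) * B n)" for n
      using sums_mult[OF shifted_qLi_sums[OF assms(1), of "Suc n"], of "q ^ Suc n * B n"]
      by (simp add: a_def mult_ac)
  qed
  moreover
  \<comment> \<open>Here \<open>m\<close> is again fixed and the bracket index starts at
    \<open>Suc m\<close>. After expanding \<open>shifted_qLi\<close>, the sum over \<open>n\<close>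
    telescopes with lag \<open>Suc i\<close>.\<close>
  have right: "(\<lambda>n. q ^ (Suc m + n) / qbracket q (Suc m + n) * shifted_qLi q l (Suc m + n))
      sums (q ^ Suc m * (P m + L / qbracket q (Suc m)))" for m
  proof (rule sums_swap_nonneg)
    let ?b = "\<lambda>i. (q ^ l) ^ Suc i / qbracket q (Suc i) ^ l"
    let ?f = "\<lambda>i n. ?b i * (q ^ (Suc m + n) / (qbracket q (Suc m + n) * qbracket q (Suc m + n + Suc i)))"
    show "0 \<le> ?f i n" for i n
      using q0 br0 by simp
    show "(\<lambda>i. q ^ Suc m * (b i * R m i + b i / qbracket q (Suc m)))
        sums (q ^ Suc m * (P m + L / qbracket q (Suc m)))"
      by (intro sums_mult sums_add sums_divide bR bL)
    show "?f i sums (q ^ Suc m * (b i * R m i + b i / qbracket q (Suc m)))" for i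
    proof -
      \<comment> \<open>The summand \<open>n = 0\<close> is split off; it yields the additional
        \<open>1 / qbracket q (Suc m)\<close>, and the others form \<open>R m i\<close>.\<close>
      have "(\<Sum>n<Suc i. q ^ (Suc m + n) / qbracket q (Suc m + n))
          = q ^ Suc m * (R m i + 1 / qbracket q (Suc m))"
        unfolding sum.lessThan_Suc_shift R_def distrib_left sum_distrib_left
        by (simp add: power_add mult_ac)
      then have "?f i sums (?b i * (q ^ Suc m * (R m i + 1 / qbracket q (Suc m)) / qbracket q (Suc i)))"
        using sums_mult[OF partial_fraction_sums[of "Suc m" "Suc i"], of "?b i"] by simp
      then show ?thesis
        by (simp add: b_def distrib_left add_divide_distrib mult_ac)
    qed
    show "(\<lambda>i. ?f i n) sums (q ^ (Suc m + n) / qbracket q (Suc m + n) * shifted_qLi q l (Suc m + n))" for n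
      using sums_mult[OF shifted_qLi_sums[OF assms(2), of "Suc m + n"],
          of "q ^ (Suc m + n) / qbracket q (Suc m + n)"]
      by (simp add: ac_simps)
  qed
  have "(\<lambda>n. (\<Sum>m\<le>n. c m) / qbracket q (Suc n) * q ^ Suc n * shifted_qLi q l (Suc n))
      sums (s + L * qLi q (Suc k) (q ^ k))"
  proof (rule sums_swap_nonneg)
    let ?w = "\<lambda>n. q ^ Suc n / qbracket q (Suc n) * shifted_qLi q l (Suc n)"
    \<comment> \<open>Expanding \<open>qzeta\<close> gives pairs \<open>m \<le> n\<close>. The row
      for \<open>m\<close> vanishes below \<open>n = m\<close>, so it may be shifted to start there,
      where \<open>right\<close> applies.\<close>
    let ?f = "\<lambda>m n. if m \<le> n then c m * ?w n else 0"
    show "0 \<le> ?f m n" for m n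
      using c0 q0 br0 shifted_qLi_nonneg[OF assms(2)] by simp
    show "(\<lambda>m. a m * P m + L * (a m / qbracket q (Suc m))) sums (s + L * qLi q (Suc k) (q ^ k))"
      by (intro sums_add aP sums_mult aL')
    show "?f m sums (a m * P m + L * (a m / qbracket q (Suc m)))" for m
    proof -
      have "(\<lambda>n. c m * ?w (n + m)) sums (c m * (q ^ Suc m * (P m + L / qbracket q (Suc m))))"
        using sums_mult[OF right[of m], of "c m"] by (simp add: add.commute)
      then have "(\<lambda>n. ?f m (n + m)) sums (a m * (P m + L / qbracket q (Suc m)))"
        by (simp add: ca[symmetric] mult.assoc)
      then show ?thesis
        by (subst (asm) sums_zero_iff_shift) (auto simp: distrib_left mult.commute)
    qed
    show "(\<lambda>m. ?f m n) sums ((\<Sum>m\<le>n. c m) / qbracket q (Suc n) * q ^ Suc n * shifted_qLi q l (Suc n))" for n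
      using sums_If_finite_set[of "{..n}" "\<lambda>m. c m * ?w n"]
      unfolding sum_distrib_right[symmetric] by (simp add: mult_ac)
  qed
  then have "(\<lambda>n. qzeta q (Suc n) k (q ^ (k - 1)) / qbracket q (Suc n) * q ^ Suc n * shifted_qLi q l (Suc n))
      sums (s + L * qLi q (Suc k) (q ^ k))"
    by (simp only: qzeta_Suc_atMost c_def)
  ultimately show ?thesis
    unfolding B_def L_def by (rule that)
qed

end

section \<open>Assembly of the identity\<close>

theorem theorem1p3:
  fixes q :: real and k l :: nat
  assumes "0 < q" and "q < 1" and "k \<ge> 1" and "l \<ge> 1"
  shows
    "(-1) ^ (k - 1) * qS q [(l + 1, q ^ l), (1, q)] k q
       + (-1) ^ (l - 1) * qS q [(k, q ^ (k - 1)), (1, q)] (l + 1) q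
     = qLi q (l + 1) (q ^ l) * qLi q (k + 1) (q ^ k)
       + (\<Sum>j=1..k-1. (-1) ^ (j - 1) * qLi q (k + 1 - j) (q ^ (k - j)) * qS q [(j, q)] (l + 1) (q ^ l))
       + (-1) ^ (k - 1) * qLi q (l + 1) (q ^ l) * qS q [(1, q)] k q
       - (\<Sum>j=1..k-1. (-1) ^ (j - 1) * qLi q (k + 1 - j) (q ^ (k - j)) * qLi q (l + j + 1) (q ^ (l + 1)))
       - (\<Sum>j=1..l-1. (-1) ^ (j - 1) * qLi q (l + 1 - j) (q ^ (l - j)) * qS q [(k, q ^ (k - 1))] (j + 1) q)"
proof -
  note q = assms(1,2)
  have k: "0 < k" and l: "0 < l"
    using assms by auto
  let ?L = "qLi q (l + 1) (q ^ l)"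
  let ?c = "\<lambda>k j. (-1) ^ (j - 1) * qLi q (k + 1 - j) (q ^ (k - j))"
  obtain s where s:
    "(\<lambda>n. q ^ Suc n * shifted_qLi q k (Suc n) * (?L - qzeta q (Suc n) (l + 1) (q ^ l))) sums s"
    "(\<lambda>n. qzeta q (Suc n) k (q ^ (k - 1)) / qbracket q (Suc n) * q ^ Suc n * shifted_qLi q l (Suc n))
      sums (s + ?L * qLi q (k + 1) (q ^ k))"
    using qLi_exchange[OF q k l] unfolding Suc_eq_plus1 by blast
  have le_1: "\<bar>q ^ i\<bar> \<le> 1" for i
    using q by (simp add: power_le_one)
  have "(\<lambda>n. q ^ Suc n * shifted_qLi q k (Suc n))
      sums ((\<Sum>j=1..k-1. ?c k j * qLi q j q) + (-1) ^ (k - 1) * qS q [(1, q)] k q)"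
    using shifted_qLi_qS_sums[OF q _ k, of "[]" 0] by (simp add: qS_Nil[OF q])
  moreover have "(\<lambda>n. q ^ Suc n * shifted_qLi q k (Suc n) * qzeta q (Suc n) (l + 1) (q ^ l))
      sums ((\<Sum>j=1..k-1. ?c k j * qS q [(l + 1, q ^ l)] j q)
        + (-1) ^ (k - 1) * qS q [(l + 1, q ^ l), (1, q)] k q)"
    using shifted_qLi_qS_sums[OF q _ k, of "[(l + 1, q ^ l)]" 0] le_1 by (simp add: mult_ac)
  ultimately have "(\<lambda>n. ?L * (q ^ Suc n * shifted_qLi q k (Suc n))
        - q ^ Suc n * shifted_qLi q k (Suc n) * qzeta q (Suc n) (l + 1) (q ^ l))
      sums (?L * ((\<Sum>j=1..k-1. ?c k j * qLi q j q) + (-1) ^ (k - 1) * qS q [(1, q)] k q)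
        - ((\<Sum>j=1..k-1. ?c k j * qS q [(l + 1, q ^ l)] j q)
          + (-1) ^ (k - 1) * qS q [(l + 1, q ^ l), (1, q)] k q))"
    by (intro sums_diff sums_mult)
  \<comment> \<open>The common value \<open>s\<close> is computed here from the first series and in
    \<open>right\<close> from the second; equating the two gives the claim after a stuffle.\<close>
  then have left: "s = ?L * ((\<Sum>j=1..k-1. ?c k j * qLi q j q) + (-1) ^ (k - 1) * qS q [(1, q)] k q)
        - ((\<Sum>j=1..k-1. ?c k j * qS q [(l + 1, q ^ l)] j q)
          + (-1) ^ (k - 1) * qS q [(l + 1, q ^ l), (1, q)] k q)"
    using s(1) by (intro sums_unique2[of _ s]) (simp_all add: algebra_simps)
  have "(\<lambda>n. qzeta q (Suc n) k (q ^ (k - 1)) / qbracket q (Suc n) * q ^ Suc n * shifted_qLi q l (Suc n))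
      sums ((\<Sum>j=1..l-1. ?c l j * qS q [(k, q ^ (k - 1))] (j + 1) q)
        + (-1) ^ (l - 1) * qS q [(k, q ^ (k - 1)), (1, q)] (l + 1) q)"
    using shifted_qLi_qS_sums[OF q _ l, of "[(k, q ^ (k - 1))]" 1] le_1 by simp
  then have right: "s + ?L * qLi q (k + 1) (q ^ k)
      = (\<Sum>j=1..l-1. ?c l j * qS q [(k, q ^ (k - 1))] (j + 1) q)
        + (-1) ^ (l - 1) * qS q [(k, q ^ (k - 1)), (1, q)] (l + 1) q"
    using s(2) by (rule sums_unique2[rotated])
  \<comment> \<open>The stuffle product exchanges the columns to reach the form in the claim. Its
    products \<open>?L * qLi q j q\<close> cancel those in \<open>left\<close>.\<close>
  have "qS q [(l + 1, q ^ l)] j q = ?L * qLi q j q + qLi q (l + j + 1) (q ^ (l + 1))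
      - qS q [(j, q)] (l + 1) (q ^ l)" for j
    using qS_stuffle[OF q, of "q ^ l" q "l + 1" j] q power_less_1[OF q l]
    by (simp add: ac_simps)
  then have "(\<Sum>j=1..k-1. ?c k j * qS q [(l + 1, q ^ l)] j q)
      = ?L * (\<Sum>j=1..k-1. ?c k j * qLi q j q)
        + (\<Sum>j=1..k-1. ?c k j * qLi q (l + j + 1) (q ^ (l + 1)))
        - (\<Sum>j=1..k-1. ?c k j * qS q [(j, q)] (l + 1) (q ^ l))"
    by (simp add: distrib_left right_diff_distrib sum.distrib sum_subtractf sum_distrib_left mult.left_commute)
  with left right show ?thesis
    by (simp add: algebra_simps)
qed

end
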